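(* Let $G$ be an $N$-graph with assigned angles in $\mathbb R^2$. Suppose that every junction of $G$ has order at most $4$ and that, if $p$ is a junction with $\pi^{-1}(p)=\{(z_1,i_1),\dots,(z_k,i_k)\}$, then the vectors $d^{z_1,i_1},\dots,d^{z_k,i_k}$ are distinct and form pairwise angles equal to $\tfrac{n\pi}{2}$ with $n\in\{1,2,3\}$. Let $H\subseteq G$ be a connected stratified straight subgraph and let $(H,\Sigma_0)$ be the first stratum of (a stratification of) $H$. Suppose that for every edge $E_{i_0}$ of $\mathrm{Sing}((H,\Sigma_0))$ there does not exist a cycle $\mathcal P=(\mathcal P(1),\dots,\mathcal P(\mathcal J))$ in $H$ such that, for some $z_0\in\{0,1\}$, $\mathcal P(1)=(z_0,i_0)$ and, for the canonical assignment $\hat d$ on $H$ normalized by $\hat d^{\,z_0,i_0}=(1,0)$, $$\hat d^{\,\mathcal P(j)}\neq(-1,0)\qquad\text{for all } j=2,\dots,\mathcal J .$$ Then $H$ is straight.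
   Context: Let $I_i=[0,1]\times\{i\}$ for $i=1,\dots,N$, $E=\bigcup_i I_i$, $V=\bigcup_i\{0,1\}\times\{i\}$. An $N$-graph is a topological quotient $G=E/\sim$, where $\sim$ identifies points of $V$ only; $\pi:E\to G$ is the projection, $E_i=\pi(I_i)$ the edges, $V_G=\pi(V)$ the vertices (junctions). The order of $p\in V_G$ is the cardinality of $\pi^{-1}(p)\subset\{0,1\}\times\{1,\dots,N\}$. A subgraph is the union of a (possibly empty) collection of edges with the same identifications. $G$ has assigned angles if a unit vector $d^{z,i}\in\mathbb S^1$ is given for each $(z,i)\in\{0,1\}\times\{1,\dots,N\}$; subgraphs inherit the assignment. A network is a pair $(G,\Gamma)$ with $\Gamma:G\to\mathbb R^2$ continuous such that each $\gamma^i=\Gamma|_{E_i}$ (a map on $[0,1]$) is either constant (singular curve) or an $H^2$ immersion (regular curve). $\mathrm{Sing}$ (resp. $\mathrm{Reg}$) of a network is the subgraph formed by the edges carrying singular (resp. regular) curves; the network is regular if $\mathrm{Sing}$ is empty. For a regular curve, $\tau^{z,i}=(-1)^z\dot\gamma^i(z)/|\dot\gamma^i(z)|$, $z\in\{0,1\}$. For nonzero planar vectors $a,b$, $\angle a,b$ is the counterclockwise angle from $a$ to $b$, modulo $2\pi$. A path composed of $\mathcal J$ edges is a sequence $\mathcal P(j)=(z_j,i_j)\in\{0,1\}\times\{1,\dots,N\}$, $j=1,\dots,\mathcal J$, with $\pi(1-z_j,i_j)=\pi(z_{j+1},i_{j+1})$ for $j<\mathcal J$. It is a cycle if moreover $\pi(1-z_{\mathcal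 J},i_{\mathcal J})=\pi(z_1,i_1)$. It is in $H$ if all $E_{i_j}$ are edges of $H$. Angle condition (for a network $(H,\Sigma)$, possibly singular): (i) for every vertex $p$ there is a rotation $\mathrm R_p$ of $\mathbb R^2$ with $\tau^{z,i}=\mathrm R_p(d^{z,i})$ for all $(z,i)\in\pi^{-1}(p)$ with $E_i$ in the network carrying a regular curve; (ii) for every cycle with all edges in $\mathrm{Sing}$, $\sum_{j=1}^{\mathcal J}\angle(-d^{1-z_j,i_j}),d^{z_{j+1},i_{j+1}}=0$ mod $2\pi$ (indices mod $\mathcal J$); (iii) for every path with $\mathcal J\ge2$, first and last edges in $\mathrm{Reg}$ and all other edges in $\mathrm{Sing}$, $\sum_{j=1}^{\mathcal J-1}\angle(-d^{1-z_j,i_j}),d^{z_{j+1},i_{j+1}}=\angle(-\tau^{1-z_1,i_1}),\tau^{z_{\mathcal J},i_{\mathcal J}}$ mod $2\pi$. (Equivalently, one can choose for each singular curve unit vectors $\tau^{0,i}=-\tau^{1,i}$ so that at each vertex all the $\tau^{z,i}$ are a common rotation of the $d^{z,i}$.) $H\subseteq G$ is stratified straight if there are subgraphs $\emptyset=H_q\subset\dots\subset H_1\subset H_0=H$ (strata) and maps $\Sigma_j:H_j\to\mathbb R^2$, $j=0,\dots,q-1$, such that $(H_j,\Sigma_j)$ is a (possibly singular) network satisfying the angle condition whose curves are (possibly constant) straight segments, and $H_{j+1}=\mathrm{Sing}((H_j,\Sigma_j))$. The first stratum is $(H,\Sigma_0)=(H_0,\Sigma_0)$. $H$ is straight if there is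 a regular network $(H,\Gamma)$ satisfying the angle condition all of whose curves are straight segments (of positive length). Canonical assignment: given a connected stratified straight subgraph $H$ (with directions as in the claim), an edge $E_{i_0}$ of $H$ and $z_0\in\{0,1\}$, there is a unique choice of vectors $\hat d^{\,z,i}\in\{(\pm1,0),(0,\pm1)\}$, for $E_i$ an edge of $H$ and $z\in\{0,1\}$, such that $\hat d^{\,z_0,i_0}=(1,0)$, $\hat d^{\,0,i}=-\hat d^{\,1,i}$ for all $i$, and at each vertex of $H$ the vectors $\hat d^{\,z,i}$ are obtained from the vectors $d^{z,i}$ by a common rotation. *)

theory Defs
  imports "HOL-Analysis.Analysis" "HOL-Library.Real_Mod"
begin

text \<open>
  The plane is \<^typ>\<open>complex\<close>. A point \<open>(t, i)\<close> with \<open>0 \<le> t \<le> 1\<close> lies on the interval \<open>I\<^sub>i\<close>;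
  the pairs with \<open>t \<in> {0, 1}\<close> are the endpoints, and endpoints also serve as oriented edges
  (\<open>(z, i)\<close> is the edge \<open>i\<close> traversed from \<open>z\<close> to \<open>1 - z\<close>).
  A subgraph is represented by the set of indices of its edges.
\<close>

record ngraph =
  nedges :: nat
  glue :: "((real \<times> nat) \<times> (real \<times> nat)) set"

definition edges :: "ngraph \<Rightarrow> nat set"
  where "edges G = {1..nedges G}"

definition points :: "nat set \<Rightarrow> (real \<times> nat) set"
  where "points S = {0..1} \<times> S"

definition endpoints :: "nat set \<Rightarrow> (real \<times> nat) set"
  where "endpoints S = {0, 1} \<times> S"

definition is_ngraph :: "ngraph \<Rightarrow> bool"
  where "is_ngraph G \<longleftrightarrow>
    equiv (points (edges G)) (glue G) \<and>
    (\<forall>(x, y) \<in> glue G. x \<noteq> y \<longrightarrow> x \<in> endpoints (edges G) \<and> y \<in> endpoints (edges G))"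

definition proj :: "ngraph \<Rightarrow> real \<times> nat \<Rightarrow> (real \<times> nat) set"
  where "proj G x = glue G `` {x}"

definition space_of :: "ngraph \<Rightarrow> nat set \<Rightarrow> (real \<times> nat) set set"
  where "space_of G S = proj G ` points S"

text \<open>Quotient topology, then the subspace topology on a subgraph.\<close>

definition quotient_top :: "ngraph \<Rightarrow> (real \<times> nat) set topology"
  where "quotient_top G = topology (\<lambda>U. U \<subseteq> space_of G (edges G) \<and>
    openin (top_of_set (points (edges G))) {x \<in> points (edges G). proj G x \<in> U})"

definition subgraph_top :: "ngraph \<Rightarrow> nat set \<Rightarrow> (real \<times> nat) set topology"
  where "subgraph_top G S = subtopology (quotient_top G) (space_of G S)"

lemma openin_quotient_top:
  "openin (quotient_top G) U \<longleftrightarrow> U \<subseteq> space_of G (edges G) \<and>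
    openin (top_of_set (points (edges G))) {x \<in> points (edges G). proj G x \<in> U}"
proof -
  let ?E = "points (edges G)"
  have "istopology (\<lambda>U. U \<subseteq> space_of G (edges G) \<and>
      openin (top_of_set ?E) {x \<in> ?E. proj G x \<in> U})"
    unfolding istopology_def
  proof (intro conjI allI impI)
    fix A B
    assume A: "A \<subseteq> space_of G (edges G) \<and> openin (top_of_set ?E) {x \<in> ?E. proj G x \<in> A}"
      and B: "B \<subseteq> space_of G (edges G) \<and> openin (top_of_set ?E) {x \<in> ?E. proj G x \<in> B}"
    have "{x \<in> ?E. proj G x \<in> A \<inter> B} = {x \<in> ?E. proj G x \<in> A} \<inter> {x \<in> ?E. proj G x \<in> B}"
      by auto
    with A B show "openin (top_of_set ?E) {x \<in> ?E. proj G x \<in> A \<inter> B}"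
      by (simp add: openin_Int)
    show "A \<inter> B \<subseteq> space_of G (edges G)" using A by auto
  next
    fix \<K>
    assume K: "\<forall>K\<in>\<K>. K \<subseteq> space_of G (edges G) \<and> openin (top_of_set ?E) {x \<in> ?E. proj G x \<in> K}"
    have "{x \<in> ?E. proj G x \<in> \<Union>\<K>} = (\<Union>K\<in>\<K>. {x \<in> ?E. proj G x \<in> K})"
      by auto
    moreover have "openin (top_of_set ?E) (\<Union>K\<in>\<K>. {x \<in> ?E. proj G x \<in> K})"
      using K by (intro openin_Union) auto
    ultimately show "openin (top_of_set ?E) {x \<in> ?E. proj G x \<in> \<Union>\<K>}" by simp
    show "\<Union>\<K> \<subseteq> space_of G (edges G)" using K by auto
  qed
  then show ?thesis
    unfolding quotient_top_def by (simp add: topology_inverse')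
qed

definition vertices :: "ngraph \<Rightarrow> nat set \<Rightarrow> (real \<times> nat) set set"
  where "vertices G S = proj G ` endpoints S"

definition fiber :: "ngraph \<Rightarrow> (real \<times> nat) set \<Rightarrow> (real \<times> nat) set"
  where "fiber G p = {x \<in> points (edges G). proj G x = p}"

definition vertex_order :: "ngraph \<Rightarrow> (real \<times> nat) set \<Rightarrow> nat"
  where "vertex_order G p = card (fiber G p)"

definition assigned_angles :: "ngraph \<Rightarrow> (real \<times> nat \<Rightarrow> complex) \<Rightarrow> bool"
  where "assigned_angles G d \<longleftrightarrow> (\<forall>x \<in> endpoints (edges G). norm (d x) = 1)"

definition plane_rotation :: "(complex \<Rightarrow> complex) \<Rightarrow> bool"
  where "plane_rotation R \<longleftrightarrow> (\<exists>\<theta>. R = (\<lambda>v. cis \<theta> * v))"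

text \<open>Counterclockwise angle from \<open>a\<close> to \<open>b\<close>, represented in \<open>[0, 2 * pi)\<close>.\<close>

definition ccw_angle :: "complex \<Rightarrow> complex \<Rightarrow> real"
  where "ccw_angle a b = Arg2pi (b / a)"

text \<open>
  One-dimensional Sobolev space \<open>H\<^sup>2(0, 1)\<close>, given by its \<open>C\<^sup>1\<close> representatives: \<open>\<gamma>'\<close> is the
  integral of a square-integrable function.
\<close>

definition velocity :: "(real \<Rightarrow> complex) \<Rightarrow> real \<Rightarrow> complex"
  where "velocity \<gamma> t = vector_derivative \<gamma> (at t within {0..1})"

definition sobolev_H2 :: "(real \<Rightarrow> complex) \<Rightarrow> bool"
  where "sobolev_H2 \<gamma> \<longleftrightarrow>
    (\<forall>t\<in>{0..1}. \<gamma> differentiable (at t within {0..1})) \<and>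
    (\<exists>g. set_borel_measurable lborel {0..1} g \<and>
         set_integrable lborel {0..1} (\<lambda>t. (norm (g t))\<^sup>2) \<and>
         (\<forall>t\<in>{0..1}. velocity \<gamma> t = velocity \<gamma> 0 + (LINT s:{0..t}|lborel. g s)))"

definition H2_immersion :: "(real \<Rightarrow> complex) \<Rightarrow> bool"
  where "H2_immersion \<gamma> \<longleftrightarrow> sobolev_H2 \<gamma> \<and> (\<forall>t\<in>{0..1}. velocity \<gamma> t \<noteq> 0)"

definition curve :: "ngraph \<Rightarrow> ((real \<times> nat) set \<Rightarrow> complex) \<Rightarrow> nat \<Rightarrow> real \<Rightarrow> complex"
  where "curve G \<Gamma> i t = \<Gamma> (proj G (t, i))"

definition singular_curve :: "(real \<Rightarrow> complex) \<Rightarrow> bool"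
  where "singular_curve \<gamma> \<longleftrightarrow> \<gamma> constant_on {0..1}"

definition is_network :: "ngraph \<Rightarrow> nat set \<Rightarrow> ((real \<times> nat) set \<Rightarrow> complex) \<Rightarrow> bool"
  where "is_network G S \<Gamma> \<longleftrightarrow>
    continuous_map (subgraph_top G S) euclidean \<Gamma> \<and>
    (\<forall>i\<in>S. singular_curve (curve G \<Gamma> i) \<or> H2_immersion (curve G \<Gamma> i))"

definition Sing :: "ngraph \<Rightarrow> nat set \<Rightarrow> ((real \<times> nat) set \<Rightarrow> complex) \<Rightarrow> nat set"
  where "Sing G S \<Gamma> = {i \<in> S. singular_curve (curve G \<Gamma> i)}"

definition Reg :: "ngraph \<Rightarrow> nat set \<Rightarrow> ((real \<times> nat) set \<Rightarrow> complex) \<Rightarrow> nat set"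
  where "Reg G S \<Gamma> = {i \<in> S. H2_immersion (curve G \<Gamma> i)}"

definition regular_network :: "ngraph \<Rightarrow> nat set \<Rightarrow> ((real \<times> nat) set \<Rightarrow> complex) \<Rightarrow> bool"
  where "regular_network G S \<Gamma> \<longleftrightarrow> is_network G S \<Gamma> \<and> Sing G S \<Gamma> = {}"

definition tau :: "ngraph \<Rightarrow> ((real \<times> nat) set \<Rightarrow> complex) \<Rightarrow> real \<times> nat \<Rightarrow> complex"
  where "tau G \<Gamma> = (\<lambda>(z, i). (if z = 0 then 1 else - 1) *
    (velocity (curve G \<Gamma> i) z / of_real (norm (velocity (curve G \<Gamma> i) z))))"

definition opp :: "real \<times> nat \<Rightarrow> real \<times> nat"
  where "opp = (\<lambda>(z, i). (1 - z, i))"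

text \<open>
  Paths are nonempty lists of oriented edges, so the \<open>j\<close>-th entry is \<open>P ! (j - 1)\<close>.
\<close>

definition is_path :: "ngraph \<Rightarrow> (real \<times> nat) list \<Rightarrow> bool"
  where "is_path G P \<longleftrightarrow> P \<noteq> [] \<and> set P \<subseteq> endpoints (edges G) \<and>
    (\<forall>j. Suc j < length P \<longrightarrow> proj G (opp (P ! j)) = proj G (P ! Suc j))"

definition is_cycle :: "ngraph \<Rightarrow> (real \<times> nat) list \<Rightarrow> bool"
  where "is_cycle G P \<longleftrightarrow> is_path G P \<and> proj G (opp (last P)) = proj G (hd P)"

definition path_in :: "(real \<times> nat) list \<Rightarrow> nat set \<Rightarrow> bool"
  where "path_in P S \<longleftrightarrow> snd ` set P \<subseteq> S"

definition angle_condition ::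
  "ngraph \<Rightarrow> (real \<times> nat \<Rightarrow> complex) \<Rightarrow> nat set \<Rightarrow> ((real \<times> nat) set \<Rightarrow> complex) \<Rightarrow> bool"
  where "angle_condition G d S \<Gamma> \<longleftrightarrow>
    (\<forall>p \<in> vertices G S. \<exists>R. plane_rotation R \<and>
       (\<forall>(z, i) \<in> fiber G p. i \<in> Reg G S \<Gamma> \<longrightarrow> tau G \<Gamma> (z, i) = R (d (z, i)))) \<and>
    (\<forall>P. is_cycle G P \<and> path_in P (Sing G S \<Gamma>) \<longrightarrow>
       [(\<Sum>j<length P. ccw_angle (- d (opp (P ! j))) (d (P ! (Suc j mod length P)))) = 0]
         (rmod (2 * pi))) \<and>
    (\<forall>P. is_path G P \<and> 2 \<le> length P \<and>
         snd (hd P) \<in> Reg G S \<Gamma> \<and> snd (last P) \<in> Reg G S \<Gamma> \<and>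
         path_in (butlast (tl P)) (Sing G S \<Gamma>) \<longrightarrow>
       [(\<Sum>j<length P - 1. ccw_angle (- d (opp (P ! j))) (d (P ! Suc j)))
         = ccw_angle (- tau G \<Gamma> (opp (hd P))) (tau G \<Gamma> (last P))] (rmod (2 * pi)))"

text \<open>
  A possibly constant straight segment with arbitrary parametrization. Network curves are
  constant or immersed, so the condition on the image excludes backtracking.
\<close>

definition straight_curve :: "(real \<Rightarrow> complex) \<Rightarrow> bool"
  where "straight_curve \<gamma> \<longleftrightarrow> \<gamma> ` {0..1} = closed_segment (\<gamma> 0) (\<gamma> 1)"

definition stratification ::
  "ngraph \<Rightarrow> (real \<times> nat \<Rightarrow> complex) \<Rightarrow> nat set \<Rightarrow> nat \<Rightarrow> (nat \<Rightarrow> nat set) \<Rightarrow>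
   (nat \<Rightarrow> (real \<times> nat) set \<Rightarrow> complex) \<Rightarrow> bool"
  where "stratification G d S q Hs \<Sigma> \<longleftrightarrow>
    Hs 0 = S \<and> Hs q = {} \<and>
    (\<forall>j<q. Hs (Suc j) \<subset> Hs j \<and>
       is_network G (Hs j) (\<Sigma> j) \<and> angle_condition G d (Hs j) (\<Sigma> j) \<and>
       (\<forall>i\<in>Hs j. straight_curve (curve G (\<Sigma> j) i)) \<and>
       Hs (Suc j) = Sing G (Hs j) (\<Sigma> j))"

text \<open>A regular curve has nonvanishing velocity, so these segments have positive length.\<close>

definition straight :: "ngraph \<Rightarrow> (real \<times> nat \<Rightarrow> complex) \<Rightarrow> nat set \<Rightarrow> bool"
  where "straight G d S \<longleftrightarrow>
    (\<exists>\<Gamma>. regular_network G S \<Gamma> \<and> angle_condition G d S \<Gamma> \<and>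
         (\<forall>i\<in>S. straight_curve (curve G \<Gamma> i)))"

definition connected_subgraph :: "ngraph \<Rightarrow> nat set \<Rightarrow> bool"
  where "connected_subgraph G S \<longleftrightarrow> connectedin (quotient_top G) (space_of G S)"

text \<open>
  The canonical assignment \<open>D\<close> on the subgraph \<open>S\<close> with \<open>D x\<^sub>0 = (1, 0)\<close>; it is determined only
  on the endpoints of the edges in \<open>S\<close>.
\<close>

definition canonical_assignment ::
  "ngraph \<Rightarrow> (real \<times> nat \<Rightarrow> complex) \<Rightarrow> nat set \<Rightarrow> real \<times> nat \<Rightarrow> (real \<times> nat \<Rightarrow> complex) \<Rightarrow> bool"
  where "canonical_assignment G d S x\<^sub>0 D \<longleftrightarrow>
    (\<forall>x \<in> endpoints S. D x \<in> {1, - 1, \<i>, - \<i>}) \<and>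
    D x\<^sub>0 = 1 \<and>
    (\<forall>i\<in>S. D (0, i) = - D (1, i)) \<and>
    (\<forall>p \<in> vertices G S. \<exists>R. plane_rotation R \<and>
       (\<forall>(z, i) \<in> fiber G p. i \<in> S \<longrightarrow> D (z, i) = R (d (z, i))))"

end

theory Submission
  imports Defs
begin

text \<open>
  Orient every edge of \<open>H\<close> coherently: transporting the tangent of one regular edge of
  \<open>\<Sigma> 0\<close> along paths, unchanged on edges and turned at vertices as the angles \<open>d\<close> prescribe,
  gives a unit vector \<open>D x\<close> at every endpoint \<open>x\<close> of \<open>H\<close>. The angle condition makes this independent
  of the path and makes \<open>D\<close> agree with the tangents on all regular edges (\<open>directions_exist\<close>).
  Up to a constant factor \<open>D\<close> is the canonical assignment (\<open>directions_canonical_assignment\<close>).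
  A straight regular network realising the prescribed angles therefore amounts to positions of
  the vertices for which every edge \<open>k\<close> points from \<open>(0, k)\<close> to \<open>(1, k)\<close> in the direction
  \<open>D (0, k)\<close> and has positive length (\<open>straight_if_positions\<close>). The positions given by \<open>\<Sigma> 0\<close> have
  the right directions, but the singular edges have length zero.

  A singular edge \<open>i\<close> is opened by a translation. Put \<open>u = D (0, i)\<close> and let \<open>A\<close> be the set of
  vertices that can be reached from the head of \<open>i\<close> without ever travelling in direction \<open>- u\<close>.
  Translate the vertices of \<open>A\<close> by \<open>u\<close> and leave the others in place. No edge that points in
  direction \<open>u\<close> leaves \<open>A\<close>, so such edges are only ever lengthened; an edge not parallel to \<open>u\<close> may
  be travelled both ways and so has both its ends in \<open>A\<close> or neither
  (\<open>shift_lengthens_edges\<close>). The edge \<open>i\<close> itself gets length one unless its tail lies in \<open>A\<close>, and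
  that would produce exactly a cycle excluded by the hypothesis. As these translations
  never shorten an edge and never change a direction, those of all singular edges can be added up.
\<close>

section \<open>The quotient space\<close>

lemma proj_eq_cases:
  assumes "is_ngraph G" and "x \<in> points (edges G)" and "y \<in> points (edges G)"
    and "proj G x = proj G y"
  shows "x = y \<or> x \<in> endpoints (edges G) \<and> y \<in> endpoints (edges G)"
proof -
  have "(x, x) \<in> glue G"
    using assms(1,2) by (auto simp: is_ngraph_def equiv_def refl_on_def)
  then have "(y, x) \<in> glue G"
    using assms(4) by (auto simp: proj_def)
  then show ?thesis
    using assms(1) by (auto simp: is_ngraph_def)
qed

lemma finite_endpoints: "S \<subseteq> edges G \<Longrightarrow> finite (endpoints S)"
  by (auto simp: endpoints_def edges_def intro!: finite_cartesian_product intro: finite_subset)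

lemma endpoints_subset_points: "S \<subseteq> T \<Longrightarrow> endpoints S \<subseteq> points T"
  by (auto simp: endpoints_def points_def)

lemma compact_points: "S \<subseteq> edges G \<Longrightarrow> compact (points S)"
  unfolding points_def
  by (intro compact_Times) (auto simp: edges_def intro: finite_imp_compact finite_subset)

lemma topspace_quotient_top: "topspace (quotient_top G) = space_of G (edges G)"
proof
  show "topspace (quotient_top G) \<subseteq> space_of G (edges G)"
    using openin_quotient_top openin_topspace by blast
  have "{x \<in> points (edges G). proj G x \<in> space_of G (edges G)} = points (edges G)"
    by (auto simp: space_of_def)
  then have "openin (quotient_top G) (space_of G (edges G))"
    by (simp add: openin_quotient_top)
  then show "space_of G (edges G) \<subseteq> topspace (quotient_top G)"
    by (rule openin_subset)
qed

text \<open>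
  Gluing happens only at the finitely many endpoints, so the saturation of a closed set
  differs from that set by finitely many points.
\<close>

lemma closedin_quotient_image:
  assumes G: "is_ngraph G" and K: "closed K" "K \<subseteq> points (edges G)"
  shows "closedin (quotient_top G) (proj G ` K)"
proof -
  let ?E = "points (edges G)"
  define F where "F = {x \<in> endpoints (edges G). proj G x \<in> proj G ` K}"
  have "finite F"
    unfolding F_def using finite_endpoints[of "edges G" G] by auto
  then have "closed (K \<union> F)"
    using K(1) by (simp add: closed_Un finite_imp_closed)
  moreover have "{x \<in> ?E. proj G x \<in> space_of G (edges G) - proj G ` K} = ?E - (K \<union> F)"
  proof -
    have "x \<in> F" if "x \<in> ?E" "x \<notin> K" "y \<in> K" "proj G x = proj G y" for x y
      using proj_eq_cases[OF G that(1) _ that(4)] that K(2) by (auto simp: F_def)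
    then show ?thesis
      by (auto simp: F_def space_of_def)
  qed
  ultimately have "openin (quotient_top G) (space_of G (edges G) - proj G ` K)"
    by (auto simp: openin_quotient_top openin_open Diff_eq intro!: exI[where x = "- (K \<union> F)"])
  then show ?thesis
    using K(2) by (auto simp: closedin_def topspace_quotient_top space_of_def)
qed

text \<open>
  The combinatorial content of topological connectedness. The edges where \<open>Q\<close> holds and the
  remaining ones have no vertex in common, so their images are disjoint closed sets covering \<open>H\<close>.
\<close>

lemma connected_subgraph_propagate:
  assumes G: "is_ngraph G" and H: "H \<subseteq> edges G" and conn: "connected_subgraph G H"
    and start: "x0 \<in> endpoints H" "Q x0"
    and along: "\<And>x. x \<in> endpoints H \<Longrightarrow> Q x \<Longrightarrow> Q (opp x)"
    and through: "\<And>x y. x \<in> endpoints H \<Longrightarrow> y \<in> endpoints H \<Longrightarrow> Q x \<Longrightarrow>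
      proj G x = proj G y \<Longrightarrow> Q y"
    and x: "x \<in> endpoints H"
  shows "Q x"
proof (rule ccontr)
  assume nQ: "\<not> Q x"
  have both: "Q (0, i) \<longleftrightarrow> Q (1, i)" if "i \<in> H" for i
    using along[of "(0, i)"] along[of "(1, i)"] that by (auto simp: opp_def endpoints_def)
  define A where "A = {i \<in> H. Q (0, i)}"
  define B where "B = H - A"
  have Q_iff: "Q y \<longleftrightarrow> snd y \<in> A" if "y \<in> endpoints H" for y
    using that both by (auto simp: A_def endpoints_def)
  have AB: "A \<subseteq> edges G" "B \<subseteq> edges G" "A \<union> B = H" "A \<inter> B = {}"
    using H by (auto simp: A_def B_def)
  have closed: "closedin (quotient_top G) (space_of G S)" if "S \<subseteq> edges G" for S
    unfolding space_of_def
    by (rule closedin_quotient_image[OF G])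
      (use that compact_points[OF that] in \<open>auto simp: points_def intro: compact_imp_closed\<close>)
  have disj: "space_of G A \<inter> space_of G B = {}"
  proof (rule ccontr)
    assume "space_of G A \<inter> space_of G B \<noteq> {}"
    then obtain a b where ab: "a \<in> points A" "b \<in> points B" "proj G a = proj G b"
      by (auto simp: space_of_def)
    have "a \<noteq> b" using ab AB by (auto simp: points_def)
    then have "a \<in> endpoints (edges G)" "b \<in> endpoints (edges G)"
      using proj_eq_cases[OF G _ _ ab(3)] ab AB by (auto simp: points_def)
    then have "a \<in> endpoints H" "b \<in> endpoints H" "snd a \<in> A" "snd b \<notin> A"
      using ab AB by (auto simp: points_def endpoints_def)
    then show False
      using through[of a b] ab(3) Q_iff by blast
  qed
  have "proj G y \<in> space_of G S" if "y \<in> endpoints H" "snd y \<in> S" for y S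
    using that by (auto simp: space_of_def points_def endpoints_def)
  from this[of x0 A] this[of x B] have "proj G x0 \<in> space_of G A" "proj G x \<in> space_of G B"
    using start x nQ Q_iff[of x0] Q_iff[of x] AB by (auto simp: endpoints_def B_def)
  moreover have "space_of G H = space_of G A \<union> space_of G B"
    using AB(3) by (auto simp: space_of_def points_def)
  ultimately show False
    using conn closed[OF AB(1)] closed[OF AB(2)] disj
    unfolding connected_subgraph_def connectedin_closedin by blast
qed

section \<open>Turning along paths\<close>

lemma opp_opp [simp]: "opp (opp x) = x"
  by (cases x) (simp add: opp_def)

lemma snd_opp [simp]: "snd (opp x) = snd x"
  by (cases x) (simp add: opp_def)

lemma opp_in_endpoints [simp]: "opp x \<in> endpoints S \<longleftrightarrow> x \<in> endpoints S"
  by (cases x) (auto simp: opp_def endpoints_def)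

lemma is_path_iff_successively:
  "is_path G P \<longleftrightarrow> P \<noteq> [] \<and> set P \<subseteq> endpoints (edges G) \<and>
     successively (\<lambda>x y. proj G (opp x) = proj G y) P"
  by (auto simp: is_path_def successively_conv_nth)

lemma is_path_append:
  "P \<noteq> [] \<Longrightarrow> Q \<noteq> [] \<Longrightarrow>
   is_path G (P @ Q) \<longleftrightarrow> is_path G P \<and> is_path G Q \<and> proj G (opp (last P)) = proj G (hd Q)"
  by (auto simp: is_path_iff_successively successively_append_iff)

lemma is_path_singleton [simp]: "is_path G [x] \<longleftrightarrow> x \<in> endpoints (edges G)"
  by (simp add: is_path_iff_successively)

lemma is_path_reverse: "is_path G P \<Longrightarrow> is_path G (rev (map opp P))"
  by (auto simp: is_path_iff_successively successively_map elim!: successively_mono)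

lemma path_in_append [simp]: "path_in (P @ Q) S \<longleftrightarrow> path_in P S \<and> path_in Q S"
  by (auto simp: path_in_def)

lemma path_in_Cons [simp]: "path_in (x # P) S \<longleftrightarrow> snd x \<in> S \<and> path_in P S"
  by (auto simp: path_in_def)

lemma path_in_Nil [simp]: "path_in [] S"
  by (auto simp: path_in_def)

lemma path_in_reverse [simp]: "path_in (rev (map opp P)) S \<longleftrightarrow> path_in P S"
  by (simp add: path_in_def image_image)

lemma cis_ccw_angle:
  assumes "norm a = 1" and "norm b = 1"
  shows "cis (ccw_angle a b) = b / a"
  using Arg2pi_eq[of "b / a"] assms by (simp add: ccw_angle_def cis_conv_exp norm_divide)

text \<open>
  Multiplicative form of the angle sums: by this factor a direction is multiplied when it is
  transported along the path, kept on each edge and turned at each vertex as \<open>d\<close> prescribes.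
\<close>

fun turning :: "(real \<times> nat \<Rightarrow> complex) \<Rightarrow> (real \<times> nat) list \<Rightarrow> complex"
  where
    "turning d (x # y # P) = d y / (- d (opp x)) * turning d (y # P)"
  | "turning d _ = 1"

lemma turning_append:
  "P \<noteq> [] \<Longrightarrow> Q \<noteq> [] \<Longrightarrow>
   turning d (P @ Q) = turning d P * (d (hd Q) / (- d (opp (last P)))) * turning d Q"
proof (induction d P rule: turning.induct)
  case ("2_2" d v)
  then show ?case by (cases Q) auto
qed auto

lemma turning_reverse: "turning d (rev (map opp P)) = inverse (turning d P)"
proof (induction d P rule: turning.induct)
  case (1 d x y P)
  have "turning d (rev (map opp (x # y # P)))
      = turning d (rev (map opp (y # P)) @ [opp x])"
    by simp
  also have "\<dots> = inverse (turning d (y # P)) * (d (opp x) / (- d y))"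
    by (subst turning_append) (use 1 in auto)
  finally show ?case by (simp add: field_simps)
qed auto

lemma norm_turning:
  assumes "\<And>x. x \<in> endpoints S \<Longrightarrow> norm (d x) = 1" and "set P \<subseteq> endpoints S"
  shows "norm (turning d P) = 1"
  using assms
proof (induction d P rule: turning.induct)
  case (1 d x y P)
  have "norm (d (opp x)) = 1" "norm (d y) = 1"
    by (rule "1.prems"(1), use "1.prems"(2) in simp)+
  then show ?case
    using 1 by (simp add: norm_mult norm_divide)
qed auto

lemma cis_angle_sum_eq_turning:
  assumes "\<And>x. x \<in> endpoints S \<Longrightarrow> norm (d x) = 1" and "set P \<subseteq> endpoints S"
  shows "cis (\<Sum>j<length P - 1. ccw_angle (- d (opp (P ! j))) (d (P ! Suc j))) = turning d P"
  using assms
proof (induction d P rule: turning.induct)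
  case (1 d x y P)
  have "norm (d (opp x)) = 1" "norm (d y) = 1"
    by (rule "1.prems"(1), use "1.prems"(2) in simp)+
  then have "cis (ccw_angle (- d (opp x)) (d y)) = d y / (- d (opp x))"
    by (intro cis_ccw_angle) auto
  then show ?case
    using 1 by (simp add: sum.lessThan_Suc_shift cis_mult[symmetric] del: sum.lessThan_Suc)
qed auto

text \<open>
  Between two consecutive regular edges all edges are singular, so the angle condition gives the
  turning of this piece as the quotient of their tangents. Since the two end tangents of each
  regular edge are opposite, these quotients telescope.
\<close>

lemma turning_between_regular_edges:
  assumes angle: "angle_condition G d S \<Gamma>" and SR: "S = Sing G S \<Gamma> \<union> Reg G S \<Gamma>"
    and d: "\<And>x. x \<in> endpoints (edges G) \<Longrightarrow> norm (d x) = 1"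
    and tau1: "\<And>x. x \<in> endpoints (Reg G S \<Gamma>) \<Longrightarrow> norm (tau G \<Gamma> x) = 1"
    and tau_opp: "\<And>x. x \<in> endpoints (Reg G S \<Gamma>) \<Longrightarrow> tau G \<Gamma> (opp x) = - tau G \<Gamma> x"
    and P: "is_path G P" "path_in P S" "snd (hd P) \<in> Reg G S \<Gamma>" "snd (last P) \<in> Reg G S \<Gamma>"
  shows "tau G \<Gamma> (last P) = turning d P * tau G \<Gamma> (hd P)"
  using P
proof (induction P rule: length_induct)
  case (1 P)
  let ?R = "Reg G S \<Gamma>"
  have endp: "x \<in> endpoints ?R" if "x \<in> set P" "snd x \<in> ?R" for x
    using that "1.prems"(1) by (auto simp: is_path_def endpoints_def)
  obtain x L where P: "P = x # L" using "1.prems"(1) by (cases P) (auto simp: is_path_def)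
  show ?case
  proof (cases "L = []")
    case True
    then show ?thesis using P by simp
  next
    case False
    then have "last L \<in> set L \<and> snd (last L) \<in> ?R"
      using "1.prems"(4) P by auto
    then obtain A r B where L: "L = A @ r # B" and r: "snd r \<in> ?R" and A: "\<forall>y\<in>set A. snd y \<notin> ?R"
      using split_list_first_prop[of L "\<lambda>y. snd y \<in> ?R"] by blast
    have split: "P = (x # A @ [r]) @ B" "P = (x # A) @ r # B"
      using P L by simp_all
    have first: "is_path G (x # A @ [r])"
      using "1.prems"(1) is_path_append[of "x # A @ [r]" B G] split(1) by (cases "B = []") auto
    have rest: "is_path G (r # B)"
      using "1.prems"(1) unfolding split(2) by (subst (asm) is_path_append) auto
    have "path_in A (Sing G S \<Gamma>)"
      using A "1.prems"(2) SR P L by (auto simp: path_in_def)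
    then have "[(\<Sum>j<length (x # A @ [r]) - 1.
          ccw_angle (- d (opp ((x # A @ [r]) ! j))) (d ((x # A @ [r]) ! Suc j)))
        = ccw_angle (- tau G \<Gamma> (opp (hd (x # A @ [r])))) (tau G \<Gamma> (last (x # A @ [r])))] (rmod (2 * pi))"
      by (intro angle[unfolded angle_condition_def, THEN conjunct2, THEN conjunct2, rule_format])
        (use first r "1.prems"(3) P in \<open>auto simp: butlast_append\<close>)
    then have "cis (\<Sum>j<length (x # A @ [r]) - 1.
          ccw_angle (- d (opp ((x # A @ [r]) ! j))) (d ((x # A @ [r]) ! Suc j)))
        = cis (ccw_angle (- tau G \<Gamma> (opp x)) (tau G \<Gamma> r))"
      unfolding cis_eq_iff by simp
    moreover have "cis (\<Sum>j<length (x # A @ [r]) - 1.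
          ccw_angle (- d (opp ((x # A @ [r]) ! j))) (d ((x # A @ [r]) ! Suc j)))
        = turning d (x # A @ [r])"
      by (rule cis_angle_sum_eq_turning[of "edges G"]) (use d first in \<open>auto simp: is_path_def\<close>)
    moreover have "cis (ccw_angle (- tau G \<Gamma> (opp x)) (tau G \<Gamma> r)) = tau G \<Gamma> r / tau G \<Gamma> x"
      using endp[of x] endp[of r] "1.prems"(3) r P L tau1 tau_opp by (subst cis_ccw_angle) auto
    ultimately have step: "turning d (x # A @ [r]) = tau G \<Gamma> r / tau G \<Gamma> x"
      by simp
    have nz: "tau G \<Gamma> x \<noteq> 0"
      using endp[of x] "1.prems"(3) P tau1[of x] by auto
    have "tau G \<Gamma> (last (r # B)) = turning d (r # B) * tau G \<Gamma> (hd (r # B))"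
    proof (rule "1.IH"[rule_format])
      show "length (r # B) < length P" using split(2) by simp
    qed (use rest r "1.prems" split(2) in \<open>auto split: if_splits\<close>)
    moreover have "turning d P = turning d (x # A @ [r]) * turning d (r # B)"
      using turning_append[of "x # A" "r # B" d] turning_append[of "x # A" "[r]" d] split(2)
      by simp
    ultimately show ?thesis
      using step nz split(2) by simp
  qed
qed

section \<open>Direction assignments\<close>

text \<open>
  A canonical assignment up to a common factor and for arbitrary angles: agreement with \<open>d\<close> up to a
  rotation at each vertex is expressed by ratios, which avoids choosing the rotations.
\<close>

definition directions :: "ngraph \<Rightarrow> (real \<times> nat \<Rightarrow> complex) \<Rightarrow> nat set \<Rightarrow> (real \<times> nat \<Rightarrow> complex) \<Rightarrow> bool"
  where "directions G d S D \<longleftrightarrow>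
    (\<forall>x\<in>endpoints S. norm (D x) = 1 \<and> D (opp x) = - D x) \<and>
    (\<forall>x\<in>endpoints S. \<forall>y\<in>endpoints S. proj G x = proj G y \<longrightarrow> D y / D x = d y / d x)"

lemma directionsD:
  assumes "directions G d S D" and "x \<in> endpoints S"
  shows "norm (D x) = 1" and "D (opp x) = - D x" and "D x \<noteq> 0"
  using assms by (auto simp: directions_def)

lemma directions_vertex:
  assumes "directions G d S D" and "x \<in> endpoints S" and "y \<in> endpoints S"
    and "proj G x = proj G y"
  shows "D y / D x = d y / d x"
  using assms unfolding directions_def by blast

lemma directions_start:
  assumes "directions G d S D" and "i \<in> S"
  shows "D (1, i) = - D (0, i)" and "D (0, i) = - D (1, i)"
  using directionsD(2)[OF assms(1), of "(0, i)"] assms(2) by (auto simp: opp_def endpoints_def)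

lemma fiber_edges_endpoints:
  assumes "is_ngraph G" and "S \<subseteq> edges G" and "p \<in> vertices G S"
    and "(z, i) \<in> fiber G p" and "i \<in> S"
  shows "(z, i) \<in> endpoints S"
proof -
  obtain y where "y \<in> endpoints S" "p = proj G y"
    using assms(3) by (auto simp: vertices_def)
  then show ?thesis
    using proj_eq_cases[OF assms(1), of "(z, i)" y] assms(2,4,5)
    by (auto simp: fiber_def endpoints_def points_def)
qed

lemma directions_rotation:
  assumes G: "is_ngraph G" and S: "S \<subseteq> edges G" and D: "directions G d S D"
    and d: "\<And>x. x \<in> endpoints (edges G) \<Longrightarrow> norm (d x) = 1" and p: "p \<in> vertices G S"
  shows "\<exists>R. plane_rotation R \<and> (\<forall>(z, i) \<in> fiber G p. i \<in> S \<longrightarrow> D (z, i) = R (d (z, i)))"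
proof -
  obtain y where y: "y \<in> endpoints S" "p = proj G y"
    using p by (auto simp: vertices_def)
  have d': "norm (d x) = 1" if "x \<in> endpoints S" for x
    using that d[of x] S by (auto simp: endpoints_def)
  define c where "c = D y / d y"
  have "norm c = 1"
    using d'[OF y(1)] directionsD(1)[OF D y(1)] by (simp add: c_def norm_divide)
  then have c: "cis (Arg c) = c"
    using cis_Arg[of c] by (cases "c = 0") (auto simp: sgn_eq)
  have "D (z, i) = c * d (z, i)" if x: "(z, i) \<in> fiber G p" "i \<in> S" for z i
  proof -
    have x': "(z, i) \<in> endpoints S"
      by (rule fiber_edges_endpoints[OF G S p x])
    have "D (z, i) / D y = d (z, i) / d y"
      using directions_vertex[OF D y(1) x'] x(1) y(2) by (auto simp: fiber_def)
    then show ?thesis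
      using d'[OF y(1)] directionsD(3)[OF D y(1)] by (auto simp: c_def field_simps)
  qed
  then show ?thesis
    using c unfolding plane_rotation_def
    by (intro exI[of _ "\<lambda>v. cis (Arg c) * v"] conjI exI[of _ "Arg c"]) auto
qed

text \<open>
  \<open>D\<close> is the tangent of one regular edge \<open>r\<close>, transported along paths. One path from \<open>r\<close> followed
  by the reversal of another one with the same end arrives at \<open>opp r\<close>; both ends being regular, the
  tangents force its turning to be \<open>- 1\<close>, and this says that the two paths turn equally.
\<close>

lemma directions_exist:
  assumes G: "is_ngraph G" and S: "S \<subseteq> edges G" and conn: "connected_subgraph G S"
    and angle: "angle_condition G d S \<Gamma>" and SR: "S = Sing G S \<Gamma> \<union> Reg G S \<Gamma>"
    and d: "\<And>x. x \<in> endpoints (edges G) \<Longrightarrow> norm (d x) = 1"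
    and tau1: "\<And>x. x \<in> endpoints (Reg G S \<Gamma>) \<Longrightarrow> norm (tau G \<Gamma> x) = 1"
    and tau_opp: "\<And>x. x \<in> endpoints (Reg G S \<Gamma>) \<Longrightarrow> tau G \<Gamma> (opp x) = - tau G \<Gamma> x"
    and nonempty: "Reg G S \<Gamma> \<noteq> {}"
  obtains D where "directions G d S D"
    and "\<And>x. x \<in> endpoints (Reg G S \<Gamma>) \<Longrightarrow> D x = tau G \<Gamma> x"
proof -
  note telescope = turning_between_regular_edges[OF angle SR d tau1 tau_opp]
  obtain k where k: "k \<in> Reg G S \<Gamma>" using nonempty by blast
  define r where "r = (0 :: real, k)"
  have r: "r \<in> endpoints (Reg G S \<Gamma>)" "r \<in> endpoints S" "snd r \<in> Reg G S \<Gamma>"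
    using k by (auto simp: r_def endpoints_def Reg_def)
  have SE: "endpoints S \<subseteq> endpoints (edges G)"
    using S by (auto simp: endpoints_def)
  define walk where "walk x P \<longleftrightarrow> is_path G P \<and> path_in P S \<and> hd P = r \<and> last P = x" for x P
  have walkD: "P \<noteq> []" "set P \<subseteq> endpoints (edges G)" if "walk x P" for x P
    using that by (auto simp: walk_def is_path_def)
  have step: "walk y (P @ [y])" "turning d (P @ [y]) = turning d P * (d y / (- d (opp x)))"
    if "walk x P" "y \<in> endpoints S" "proj G (opp x) = proj G y" for x y P
    using that walkD[OF that(1)] turning_append[of P "[y]" d] SE
    by (auto simp: walk_def is_path_append endpoints_def)
  have walk_opp: "walk (opp x) (P @ [opp x])" "turning d (P @ [opp x]) = - turning d P"
    if "walk x P" "x \<in> endpoints S" for x P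
    using step[OF that(1), of "opp x"] that(2) d[of "opp x"] SE
    by (auto simp: divide_eq_eq)
  (* To get from x to another edge y at the same vertex, return along x first: the two turnings
     - 1 and d y / (- d x) multiply to the desired ratio. *)
  have walk_vertex: "walk y ((P @ [opp x]) @ [y])"
      "turning d ((P @ [opp x]) @ [y]) = turning d P * (d y / d x)"
    if "walk x P" "x \<in> endpoints S" "y \<in> endpoints S" "proj G x = proj G y" for x y P
    using step[OF walk_opp(1)[OF that(1,2)] that(3)] that(4) walk_opp(2)[OF that(1,2)]
    by auto
  have ex: "\<exists>P. walk x P" if "x \<in> endpoints S" for x
  proof (rule connected_subgraph_propagate[OF G S conn r(2) _ _ _ that])
    show "\<exists>P. walk r P"
      using r SE by (intro exI[of _ "[r]"]) (auto simp: walk_def endpoints_def)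
  qed (use walk_opp(1) walk_vertex(1) in blast)+
  have unique: "turning d P = turning d Q" if P: "walk x P" and Q: "walk x Q" for x P Q
  proof -
    let ?C = "P @ rev (map opp Q)"
    have x: "d (opp x) \<noteq> 0"
      using walkD[OF P] P d[of "opp x"] last_in_set[of P] by (auto simp: walk_def)
    have ends: "hd ?C = r" "last ?C = opp r"
      using P Q walkD(1)[OF P] walkD(1)[OF Q] by (auto simp: walk_def last_rev hd_map)
    have "is_path G ?C"
      using P Q walkD(1)[OF P] walkD(1)[OF Q]
      by (subst is_path_append) (auto simp: walk_def is_path_reverse hd_rev last_map)
    moreover have "path_in ?C S"
      using P Q by (auto simp: walk_def)
    ultimately have "tau G \<Gamma> (opp r) = turning d ?C * tau G \<Gamma> r"
      using telescope[of ?C] r(3) ends by simp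
    then have "turning d ?C = - 1"
      using tau1[OF r(1)] tau_opp[OF r(1)]
      by (metis minus_mult_left mult_cancel_right1 mult_minus1 mult_right_cancel norm_zero zero_neq_one)
    moreover have "turning d ?C = - (turning d P * inverse (turning d Q))"
      using walkD(1)[OF P] walkD(1)[OF Q] P Q x
      by (subst turning_append) (auto simp: walk_def turning_reverse hd_rev last_map)
    ultimately have "turning d P * inverse (turning d Q) = 1"
      by simp
    then show ?thesis
      by (cases "turning d Q = 0") (auto simp: field_simps)
  qed
  define D where "D x = turning d (SOME P. walk x P) * tau G \<Gamma> r" for x
  have D: "D x = turning d P * tau G \<Gamma> r" if "walk x P" for x P
    unfolding D_def using unique[OF someI[of "walk x", OF that] that] by simp
  show thesis
  proof
    show "directions G d S D"
      unfolding directions_def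
    proof (intro conjI ballI impI)
      fix x assume x: "x \<in> endpoints S"
      obtain P where P: "walk x P" using ex[OF x] by blast
      have "norm (turning d P) = 1"
        using walkD(2)[OF P] d by (intro norm_turning)
      then show nD: "norm (D x) = 1"
        using tau1[OF r(1)] by (simp add: D[OF P] norm_mult)
      show "D (opp x) = - D x"
        using D[OF P] D[OF walk_opp(1)[OF P x]] walk_opp(2)[OF P x] by simp
      fix y assume y: "y \<in> endpoints S" "proj G x = proj G y"
      have "D y = D x * (d y / d x)"
        using D[OF P] D[OF walk_vertex(1)[OF P x y]] walk_vertex(2)[OF P x y] by simp
      then show "D y / D x = d y / d x"
        using nD by (metis nonzero_mult_div_cancel_left norm_zero zero_neq_one)
    qed
    show "D x = tau G \<Gamma> x" if x: "x \<in> endpoints (Reg G S \<Gamma>)" for x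
    proof -
      have "x \<in> endpoints S" "snd x \<in> Reg G S \<Gamma>"
        using x by (auto simp: endpoints_def Reg_def)
      then obtain P where P: "walk x P" using ex by blast
      then show ?thesis
        using telescope[of P] r(3) \<open>snd x \<in> Reg G S \<Gamma>\<close> D[OF P] by (simp add: walk_def)
    qed
  qed
qed

text \<open>
  Ratios of the values of \<open>D\<close> are quarter turns at each vertex and along each edge, hence
  everywhere by connectedness.
\<close>

lemma directions_canonical_assignment:
  assumes G: "is_ngraph G" and S: "S \<subseteq> edges G" and conn: "connected_subgraph G S"
    and d: "\<And>x. x \<in> endpoints (edges G) \<Longrightarrow> norm (d x) = 1"
    and right_angles: "\<And>p x y. p \<in> vertices G (edges G) \<Longrightarrow> x \<in> fiber G p \<Longrightarrow> y \<in> fiber G p \<Longrightarrow>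
      x \<noteq> y \<Longrightarrow> \<exists>n \<in> {1, 2, 3 :: nat}. ccw_angle (d x) (d y) = real n * pi / 2"
    and D: "directions G d S D" and x0: "x0 \<in> endpoints S"
  shows "canonical_assignment G d S x0 (\<lambda>x. D x / D x0)"
  unfolding canonical_assignment_def
proof (intro conjI)
  let ?Q = "{1, - 1, \<i>, - \<i>}"
  have SE: "endpoints S \<subseteq> endpoints (edges G)"
    using S by (auto simp: endpoints_def)
  have mult: "a * b \<in> ?Q" if "a \<in> ?Q" "b \<in> ?Q" for a b
    using that by auto
  have quarter: "d y / d x \<in> ?Q"
    if "x \<in> endpoints S" "y \<in> endpoints S" "proj G x = proj G y" for x y
  proof (cases "x = y")
    case True
    then show ?thesis using d[of x] that(1) SE by auto
  next
    case False
    have "proj G x \<in> vertices G (edges G)" "x \<in> fiber G (proj G x)" "y \<in> fiber G (proj G x)"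
      using that SE endpoints_subset_points[of "edges G" "edges G"]
      by (auto simp: vertices_def fiber_def)
    then obtain n :: nat where n: "n \<in> {1, 2, 3}" "ccw_angle (d x) (d y) = real n * pi / 2"
      using right_angles False by blast
    have "d y / d x = cis (real n * pi / 2)"
      unfolding n(2)[symmetric] using d[of x] d[of y] that SE by (subst cis_ccw_angle) auto
    also have "cis (3 * pi / 2) = - \<i>"
      using cis_mult[of pi "pi / 2"] by (simp add: field_simps)
    then have "cis (real n * pi / 2) \<in> ?Q"
      using n(1) by auto
    finally show ?thesis .
  qed
  have "D x / D x0 \<in> ?Q" if "x \<in> endpoints S" for x
  proof (rule connected_subgraph_propagate[OF G S conn x0 _ _ _ that])
    show "D x0 / D x0 \<in> ?Q"
      using directionsD(3)[OF D x0] by simp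
    show "D (opp y) / D x0 \<in> ?Q" if "y \<in> endpoints S" "D y / D x0 \<in> ?Q" for y
      using mult[OF that(2), of "- 1"] directionsD(2)[OF D that(1)] by simp
    show "D z / D x0 \<in> ?Q"
      if "y \<in> endpoints S" "z \<in> endpoints S" "D y / D x0 \<in> ?Q" "proj G y = proj G z" for y z
      using mult[OF that(3) quarter[OF that(1,2,4)]] directions_vertex[OF D that(1,2,4)]
        directionsD(3)[OF D that(1)]
      by (metis (no_types, lifting) nonzero_mult_div_cancel_left times_divide_eq_left times_divide_eq_right)
  qed
  then show "\<forall>x\<in>endpoints S. D x / D x0 \<in> ?Q" by blast
  show "D x0 / D x0 = 1"
    using directionsD(3)[OF D x0] by simp
  show "\<forall>i\<in>S. D (0, i) / D x0 = - (D (1, i) / D x0)"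
    using directions_start(2)[OF D] by simp
  have "directions G d S (\<lambda>x. D x / D x0)"
    using D directionsD(1,3)[OF D x0] by (auto simp: directions_def norm_divide)
  then show "\<forall>p\<in>vertices G S. \<exists>R. plane_rotation R \<and>
      (\<forall>(z, i)\<in>fiber G p. i \<in> S \<longrightarrow> D (z, i) / D x0 = R (d (z, i)))"
    using directions_rotation[where D = "\<lambda>x. D x / D x0" and d = d, OF G S _ d] by blast
qed

section \<open>Straight curves\<close>

lemma difference_quotient_tendsto:
  fixes f :: "real \<Rightarrow> 'a :: real_normed_vector"
  assumes "(f has_vector_derivative v) (at x within S)"
  shows "((\<lambda>y. (1 / (y - x)) *\<^sub>R (f y - f x)) \<longlongrightarrow> v) (at x within S)"
proof -
  have "((\<lambda>y. norm (f y - f x - (y - x) *\<^sub>R v) / norm (y - x)) \<longlongrightarrow> 0) (at x within S)"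
    using assms by (simp add: has_vector_derivative_def has_derivative_iff_norm)
  moreover have "\<forall>\<^sub>F y in at x within S. norm (f y - f x - (y - x) *\<^sub>R v) / norm (y - x)
      = norm ((1 / (y - x)) *\<^sub>R (f y - f x) - v)"
    unfolding eventually_at_filter
  proof (intro always_eventually allI impI)
    fix y assume "y \<noteq> x"
    then have "(1 / (y - x)) *\<^sub>R (f y - f x) - v = (1 / (y - x)) *\<^sub>R (f y - f x - (y - x) *\<^sub>R v)"
      by (simp add: scaleR_diff_right)
    then show "norm (f y - f x - (y - x) *\<^sub>R v) / norm (y - x)
        = norm ((1 / (y - x)) *\<^sub>R (f y - f x) - v)"
      by simp
  qed
  ultimately have "((\<lambda>y. norm ((1 / (y - x)) *\<^sub>R (f y - f x) - v)) \<longlongrightarrow> 0) (at x within S)"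
    by (rule Lim_transform_eventually)
  then show ?thesis
    using LIM_zero_cancel tendsto_norm_zero_iff by blast
qed

text \<open>A limit of difference quotients in a closed ray stays in that ray.\<close>

lemma velocity_direction:
  assumes diff: "\<gamma> differentiable (at x within {0..1})" and x: "x \<in> {0..1}"
    and nz: "velocity \<gamma> x \<noteq> 0"
    and cone: "\<And>y. y \<in> {0..1} \<Longrightarrow> y \<noteq> x \<Longrightarrow> (\<gamma> y - \<gamma> x) / of_real (y - x) / w \<in> \<real>\<^sub>\<ge>\<^sub>0"
    and w: "w \<noteq> 0"
  shows "velocity \<gamma> x / of_real (norm (velocity \<gamma> x)) = sgn w"
proof -
  let ?F = "at x within {0..1::real}"
  let ?v = "velocity \<gamma> x"
  have "(\<gamma> has_vector_derivative ?v) ?F"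
    using diff unfolding velocity_def by (simp add: vector_derivative_works)
  then have "((\<lambda>y. (1 / (y - x)) *\<^sub>R (\<gamma> y - \<gamma> x)) \<longlongrightarrow> ?v) ?F"
    by (rule difference_quotient_tendsto)
  then have "((\<lambda>y. (1 / (y - x)) *\<^sub>R (\<gamma> y - \<gamma> x) / w) \<longlongrightarrow> ?v / w) ?F"
    using w by (intro tendsto_intros)
  moreover have "\<forall>\<^sub>F y in ?F. (1 / (y - x)) *\<^sub>R (\<gamma> y - \<gamma> x) / w \<in> \<real>\<^sub>\<ge>\<^sub>0"
    unfolding eventually_at_filter
  proof (intro always_eventually allI impI)
    fix y assume "y \<noteq> x" "y \<in> {0..1}"
    moreover have "(1 / (y - x)) *\<^sub>R (\<gamma> y - \<gamma> x) / w = (\<gamma> y - \<gamma> x) / of_real (y - x) / w"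
      by (simp add: scaleR_conv_of_real divide_inverse)
    ultimately show "(1 / (y - x)) *\<^sub>R (\<gamma> y - \<gamma> x) / w \<in> \<real>\<^sub>\<ge>\<^sub>0"
      using cone by presburger
  qed
  moreover have "?F \<noteq> bot"
    using x by (simp add: trivial_limit_within)
  ultimately have "?v / w \<in> \<real>\<^sub>\<ge>\<^sub>0"
    by (intro Lim_in_closed_set[OF closed_nonneg_Reals_complex])
  then obtain r where r: "?v / w = of_real r" "r \<ge> 0"
    by (auto elim: nonneg_Reals_cases)
  then have v: "?v = of_real r * w"
    using w by (simp add: divide_eq_eq)
  then have "r > 0"
    using nz r(2) by (cases "r = 0") auto
  then show ?thesis
    using v by (simp add: norm_mult sgn_eq)
qed

text \<open>
  However the segment is parametrised, the curve can leave its first end and arrive at its second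
  one only in the direction of the segment. If the ends coincided, the curve would be constant.
\<close>

lemma tau_straight:
  assumes imm: "H2_immersion (curve G \<Gamma> i)" and straight: "straight_curve (curve G \<Gamma> i)"
  defines "w \<equiv> \<Gamma> (proj G (1, i)) - \<Gamma> (proj G (0, i))"
  shows "w \<noteq> 0" and "tau G \<Gamma> (0, i) = sgn w" and "tau G \<Gamma> (1, i) = - sgn w"
proof -
  define \<gamma> where "\<gamma> = curve G \<Gamma> i"
  have diff: "\<gamma> differentiable (at t within {0..1})" and vel: "velocity \<gamma> t \<noteq> 0" if "t \<in> {0..1}" for t
    using imm that by (auto simp: \<gamma>_def H2_immersion_def sobolev_H2_def)
  have w_def': "w = \<gamma> 1 - \<gamma> 0"
    by (simp add: w_def \<gamma>_def curve_def)
  have on_segment: "\<exists>s\<in>{0..1}. \<gamma> t = \<gamma> 0 + of_real s * w" if "t \<in> {0..1}" for t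
  proof -
    have "\<gamma> t \<in> closed_segment (\<gamma> 0) (\<gamma> 1)"
      using straight that by (auto simp: straight_curve_def \<gamma>_def)
    then show ?thesis
      by (auto simp: closed_segment_def w_def' scaleR_conv_of_real algebra_simps)
  qed
  show w: "w \<noteq> 0"
  proof
    assume "w = 0"
    then have const: "\<gamma> t = \<gamma> 0" if "t \<in> {0..1}" for t
      using on_segment[OF that] by auto
    have "(\<gamma> has_vector_derivative 0) (at 0 within {0..1})"
    proof (rule has_vector_derivative_transform[where f = "\<lambda>_. \<gamma> 0"])
      show "\<gamma> t = \<gamma> 0" if "t \<in> {0..1}" for t by (rule const[OF that])
    qed auto
    then have "velocity \<gamma> 0 = 0"
      unfolding velocity_def by (intro vector_derivative_within) (auto simp: trivial_limit_within)
    then show False using vel[of 0] by simp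
  qed
  have "(\<gamma> t - \<gamma> 0) / of_real (t - 0) / w \<in> \<real>\<^sub>\<ge>\<^sub>0" if t: "t \<in> {0..1}" "t \<noteq> 0" for t
  proof -
    obtain s where "s \<in> {0..1}" "\<gamma> t = \<gamma> 0 + of_real s * w"
      using on_segment[OF t(1)] by blast
    then have "(\<gamma> t - \<gamma> 0) / of_real (t - 0) / w = of_real (s / t)" "s / t \<ge> 0"
      using w t by auto
    then show ?thesis by (metis nonneg_Reals_of_real_iff)
  qed
  then show "tau G \<Gamma> (0, i) = sgn w"
    using velocity_direction[of \<gamma> 0 w] diff[of 0] vel[of 0] w by (simp add: tau_def \<gamma>_def)
  have "(\<gamma> t - \<gamma> 1) / of_real (t - 1) / w \<in> \<real>\<^sub>\<ge>\<^sub>0" if t: "t \<in> {0..1}" "t \<noteq> 1" for t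
  proof -
    obtain s where s: "s \<in> {0..1}" "\<gamma> t = \<gamma> 0 + of_real s * w"
      using on_segment[OF t(1)] by blast
    have "\<gamma> t - \<gamma> 1 = of_real (s - 1) * w"
      using s by (simp add: w_def' algebra_simps)
    then have "(\<gamma> t - \<gamma> 1) / of_real (t - 1) / w = of_real ((s - 1) / (t - 1))"
      using w by simp
    moreover have "(s - 1) / (t - 1) \<ge> 0"
      using s t by (intro divide_nonpos_nonpos) auto
    ultimately show ?thesis by (metis nonneg_Reals_of_real_iff)
  qed
  then show "tau G \<Gamma> (1, i) = - sgn w"
    using velocity_direction[of \<gamma> 1 w] diff[of 1] vel[of 1] w by (simp add: tau_def \<gamma>_def)
qed

section \<open>Shifting reachable parts\<close>

text \<open>
  The vertices that have to move along when the head of the edge \<open>i\<close> moves in the direction of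
  that edge and no other edge may get shorter.
\<close>

definition shifted_region :: "ngraph \<Rightarrow> nat set \<Rightarrow> (real \<times> nat \<Rightarrow> complex) \<Rightarrow> nat \<Rightarrow> (real \<times> nat) set set"
  where "shifted_region G S D i = {proj G (opp (last P)) | P.
    is_path G P \<and> path_in P S \<and> hd P = (0, i) \<and> (\<forall>x\<in>set (tl P). D x \<noteq> - D (0, i))}"

lemma shifted_region_head:
  assumes "S \<subseteq> edges G" and "i \<in> S"
  shows "proj G (1, i) \<in> shifted_region G S D i"
  using assms unfolding shifted_region_def
  by (intro CollectI exI[of _ "[(0, i)]"]) (auto simp: opp_def endpoints_def)

lemma shifted_region_step:
  assumes "S \<subseteq> edges G" and x: "x \<in> endpoints S" "D x \<noteq> - D (0, i)"
    and "proj G x \<in> shifted_region G S D i"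
  shows "proj G (opp x) \<in> shifted_region G S D i"
proof -
  obtain P where P: "is_path G P" "path_in P S" "hd P = (0, i)"
      "\<forall>x\<in>set (tl P). D x \<noteq> - D (0, i)" "proj G x = proj G (opp (last P))"
    using assms(4) by (auto simp: shifted_region_def)
  have "P \<noteq> []" using P(1) by (simp add: is_path_def)
  moreover have "x \<in> endpoints (edges G)" "snd x \<in> S"
    using x(1) assms(1) by (auto simp: endpoints_def)
  ultimately show ?thesis
    using P x(2) unfolding shifted_region_def
    by (intro CollectI exI[of _ "P @ [x]"]) (auto simp: is_path_append)
qed

text \<open>A path by which the shift would reach the tail of its own edge is a cycle through that edge.\<close>

lemma shifted_region_tail:
  assumes "\<not> (\<exists>P. is_cycle G P \<and> path_in P S \<and> hd P = (0, i) \<and> (\<forall>x\<in>set (tl P). D x \<noteq> - D (0, i)))"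
  shows "proj G (0, i) \<notin> shifted_region G S D i"
  using assms by (auto simp: shifted_region_def is_cycle_def)

text \<open>
  Travelling along an edge in the direction of the shift, one may enter the region but not leave
  it, so the shift cannot shorten such an edge. An edge not parallel to the shift can be travelled
  both ways and thus has both ends in the region or none.
\<close>

lemma shift_lengthens_edges:
  assumes S: "S \<subseteq> edges G" and D: "directions G d S D" and k: "k \<in> S"
  shows "\<exists>c\<ge>0. D (0, i) * (of_bool (proj G (1, k) \<in> shifted_region G S D i)
      - of_bool (proj G (0, k) \<in> shifted_region G S D i)) = of_real c * D (0, k)"
proof -
  let ?A = "shifted_region G S D i"
  have k': "(0, k) \<in> endpoints S" "(1, k) \<in> endpoints S"
    using k by (auto simp: endpoints_def)
  have nz: "D (0, k) \<noteq> - D (0, k)"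
    using directionsD(3)[OF D k'(1)] by simp
  have fwd: "proj G (1, k) \<in> ?A" if "D (0, k) \<noteq> - D (0, i)" "proj G (0, k) \<in> ?A"
    using shifted_region_step[where x = "(0, k)" and D = D, OF S k'(1)] that by (simp add: opp_def)
  have bwd: "proj G (0, k) \<in> ?A" if "D (0, k) \<noteq> D (0, i)" "proj G (1, k) \<in> ?A"
    using shifted_region_step[where x = "(1, k)" and D = D, OF S k'(2)] that
      directions_start(1)[OF D k] by (simp add: opp_def)
  consider "D (0, k) = D (0, i)" | "D (0, k) = - D (0, i)"
    | "D (0, k) \<noteq> D (0, i)" "D (0, k) \<noteq> - D (0, i)"
    by blast
  then show ?thesis
  proof cases
    case 1
    then show ?thesis
      using fwd nz by (intro exI[of _ "of_bool (proj G (1, k) \<in> ?A) - of_bool (proj G (0, k) \<in> ?A)"]) auto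
  next
    case 2
    then show ?thesis
      using bwd nz by (intro exI[of _ "of_bool (proj G (0, k) \<in> ?A) - of_bool (proj G (1, k) \<in> ?A)"]) auto
  next
    case 3
    then show ?thesis
      using fwd bwd by (intro exI[of _ 0]) auto
  qed
qed

section \<open>Networks from vertex positions\<close>

lemma affine_curve:
  assumes \<gamma>: "\<And>t. t \<in> {0..1} \<Longrightarrow> \<gamma> t = of_real (1 - t) * a + of_real t * b" and ab: "a \<noteq> b"
  shows "H2_immersion \<gamma>" and "straight_curve \<gamma>" and "\<not> singular_curve \<gamma>"
    and "\<And>t. t \<in> {0..1} \<Longrightarrow> velocity \<gamma> t = b - a"
proof -
  have deriv: "(\<gamma> has_vector_derivative (b - a)) (at t within {0..1})" if "t \<in> {0..1}" for t
  proof (rule has_vector_derivative_transform[where f = "\<lambda>t. a + t *\<^sub>R (b - a)"])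
    show "\<gamma> s = a + s *\<^sub>R (b - a)" if "s \<in> {0..1}" for s
      using \<gamma>[OF that] by (simp add: scaleR_conv_of_real algebra_simps)
  qed (use that in \<open>auto intro!: derivative_eq_intros\<close>)
  show vel: "velocity \<gamma> t = b - a" if "t \<in> {0..1}" for t
    unfolding velocity_def using that deriv[OF that]
    by (intro vector_derivative_within) (auto simp: trivial_limit_within)
  have "sobolev_H2 \<gamma>"
    unfolding sobolev_H2_def
  proof (intro conjI ballI exI[of _ "\<lambda>_. 0"])
    show "\<gamma> differentiable (at t within {0..1})" if "t \<in> {0..1}" for t
      using deriv[OF that] by (rule differentiableI_vector)
  qed (auto simp: vel set_borel_measurable_def set_integrable_def)
  then show "H2_immersion \<gamma>"
    using vel ab by (simp add: H2_immersion_def)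
  have ends: "\<gamma> 0 = a" "\<gamma> 1 = b"
    using \<gamma>[of 0] \<gamma>[of 1] by auto
  have "\<gamma> ` {0..1} = closed_segment a b"
    unfolding closed_segment_image_interval
    using \<gamma> by (auto intro!: image_cong simp: scaleR_conv_of_real algebra_simps)
  then show "straight_curve \<gamma>"
    by (simp add: straight_curve_def ends)
  show "\<not> singular_curve \<gamma>"
    using ends ab unfolding singular_curve_def constant_on_def by fastforce
qed

text \<open>
  Interpolating affinely makes every edge regular, so a path to which the angle condition applies
  consists of two edges meeting at a vertex; there it only compares \<open>D\<close> with \<open>d\<close>.
\<close>

lemma straight_if_positions:
  assumes G: "is_ngraph G" and S: "S \<subseteq> edges G"
    and d: "\<And>x. x \<in> endpoints (edges G) \<Longrightarrow> norm (d x) = 1"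
    and D: "directions G d S D"
    and X: "\<And>k. k \<in> S \<Longrightarrow> \<exists>l>0. X (proj G (1, k)) - X (proj G (0, k)) = of_real l * D (0, k)"
  shows "straight G d S"
proof -
  define F where "F = (\<lambda>(t, k). of_real (1 - t) * X (proj G (0 :: real, k)) + of_real t * X (proj G (1, k)))"
  define \<Gamma> where "\<Gamma> p = F (SOME x. x \<in> points S \<and> proj G x = p)" for p
  have F_end: "F x = X (proj G x)" if "x \<in> endpoints S" for x
    using that by (auto simp: F_def endpoints_def)
  have F_eq: "F x = F y" if xy: "x \<in> points S" "y \<in> points S" "proj G x = proj G y" for x y
  proof (cases "x = y")
    case False
    have "x \<in> points (edges G)" "y \<in> points (edges G)"
      using xy S by (auto simp: points_def)
    then have "x \<in> endpoints (edges G)" "y \<in> endpoints (edges G)"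
      using proj_eq_cases[OF G _ _ xy(3)] False by auto
    then have "x \<in> endpoints S" "y \<in> endpoints S"
      using xy(1,2) by (auto simp: points_def endpoints_def)
    then show ?thesis
      using F_end xy(3) by simp
  qed simp
  have \<Gamma>_proj: "\<Gamma> (proj G x) = F x" if "x \<in> points S" for x
    unfolding \<Gamma>_def by (rule someI2[where a = x], use that in simp, rule F_eq) (use that in auto)
  have \<Gamma>_curve: "curve G \<Gamma> k t = of_real (1 - t) * X (proj G (0, k)) + of_real t * X (proj G (1, k))"
    if "k \<in> S" "t \<in> {0..1}" for k t
    using \<Gamma>_proj[of "(t, k)"] that by (simp add: curve_def F_def points_def)
  have distinct: "X (proj G (0, k)) \<noteq> X (proj G (1, k))" if "k \<in> S" for k
  proof -
    have "D (0, k) \<noteq> 0"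
      using directionsD(3)[OF D, of "(0, k)"] that by (simp add: endpoints_def)
    then show ?thesis
      using X[OF that] by force
  qed
  note aff = affine_curve[OF \<Gamma>_curve distinct]
  have Sing: "Sing G S \<Gamma> = {}"
    using aff(3) by (auto simp: Sing_def)
  have tau: "tau G \<Gamma> x = D x" if x: "x \<in> endpoints S" for x
  proof -
    obtain z k where xk: "x = (z, k)" "z \<in> {0, 1}" "k \<in> S"
      using x by (cases x) (auto simp: endpoints_def)
    obtain l where l: "l > 0" "X (proj G (1, k)) - X (proj G (0, k)) = of_real l * D (0, k)"
      using X[OF xk(3)] by blast
    have "norm (D (0, k)) = 1"
      using directionsD(1)[OF D, of "(0, k)"] xk(3) by (auto simp: endpoints_def)
    moreover have "velocity (curve G \<Gamma> k) z = of_real l * D (0, k)"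
      using aff(4)[of k z] xk l(2) by auto
    ultimately show ?thesis
      using l(1) xk directions_start(1)[OF D xk(3)] by (auto simp: tau_def norm_mult)
  qed
  have "continuous_map (subgraph_top G S) euclidean \<Gamma>"
    unfolding continuous_map_closedin
  proof (intro conjI allI impI)
    fix C :: "complex set"
    assume "closedin euclidean C"
    then have C: "closed C" by simp
    have "closed {x \<in> points S. F x \<in> C}"
    proof -
      have F_cont: "continuous_on UNIV (\<lambda>t. F (t, k))" for k
        unfolding F_def by (auto intro!: continuous_intros)
      have "closed ({t \<in> {0..1}. F (t, k) \<in> C} \<times> {k})" for k
        using closed_Int[OF closed_atLeastAtMost[of 0 1] closed_vimage[OF C F_cont[of k]]]
        by (intro closed_Times) (auto simp: Int_def vimage_def)
      moreover have "finite S"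
        using S by (auto simp: edges_def intro: finite_subset)
      ultimately have "closed (\<Union>k\<in>S. {t \<in> {0..1}. F (t, k) \<in> C} \<times> {k})"
        by (intro closed_UN) auto
      also have "(\<Union>k\<in>S. {t \<in> {0..1}. F (t, k) \<in> C} \<times> {k}) = {x \<in> points S. F x \<in> C}"
        by (auto simp: points_def)
      finally show ?thesis .
    qed
    then have "closedin (quotient_top G) (proj G ` {x \<in> points S. F x \<in> C})"
      by (rule closedin_quotient_image[OF G]) (use S in \<open>auto simp: points_def\<close>)
    then have "closedin (subgraph_top G S) (proj G ` {x \<in> points S. F x \<in> C})"
      unfolding subgraph_top_def by (rule closedin_subset_topspace) (auto simp: space_of_def)
    moreover have "topspace (subgraph_top G S) = space_of G S"
      using S unfolding subgraph_top_def topspace_subtopology topspace_quotient_top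
      by (auto simp: space_of_def points_def)
    then have "{p \<in> topspace (subgraph_top G S). \<Gamma> p \<in> C} = proj G ` {x \<in> points S. F x \<in> C}"
      by (auto simp: space_of_def \<Gamma>_proj)
    ultimately show "closedin (subgraph_top G S) {p \<in> topspace (subgraph_top G S). \<Gamma> p \<in> C}"
      by simp
  qed auto
  then have "regular_network G S \<Gamma>"
    using aff(1) Sing by (auto simp: regular_network_def is_network_def)
  moreover have "angle_condition G d S \<Gamma>"
    unfolding angle_condition_def
  proof (intro conjI ballI allI impI)
    fix p assume p: "p \<in> vertices G S"
    obtain R where R: "plane_rotation R" "\<forall>(z, i) \<in> fiber G p. i \<in> S \<longrightarrow> D (z, i) = R (d (z, i))"
      using directions_rotation[OF G S D d p] by blast
    have "tau G \<Gamma> (z, i) = R (d (z, i))" if "(z, i) \<in> fiber G p" "i \<in> Reg G S \<Gamma>" for z i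
    proof -
      have "i \<in> S" using that(2) by (simp add: Reg_def)
      then show ?thesis
        using R(2) that(1) tau[OF fiber_edges_endpoints[OF G S p that(1)]] by auto
    qed
    then show "\<exists>R. plane_rotation R \<and>
        (\<forall>(z, i)\<in>fiber G p. i \<in> Reg G S \<Gamma> \<longrightarrow> tau G \<Gamma> (z, i) = R (d (z, i)))"
      using R(1) by blast
  next
    fix P assume "is_cycle G P \<and> path_in P (Sing G S \<Gamma>)"
    then have False
      unfolding Sing by (auto simp: is_cycle_def is_path_def path_in_def)
    then show "[(\<Sum>j<length P. ccw_angle (- d (opp (P ! j))) (d (P ! (Suc j mod length P)))) = 0]
        (rmod (2 * pi))" ..
  next
    fix P assume P: "is_path G P \<and> 2 \<le> length P \<and>
         snd (hd P) \<in> Reg G S \<Gamma> \<and> snd (last P) \<in> Reg G S \<Gamma> \<and>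
         path_in (butlast (tl P)) (Sing G S \<Gamma>)"
    then have "butlast (tl P) = []"
      unfolding Sing by (simp add: path_in_def)
    then have "length P = 2"
      using P by (metis One_nat_def diff_Suc_1 length_butlast length_tl list.size(3) numeral_2_eq_2
          diff_diff_left diff_is_0_eq le_antisym one_add_one)
    then obtain x y where xy: "P = [x, y]"
      by (auto simp: numeral_2_eq_2 length_Suc_conv)
    have S': "x \<in> endpoints S" "opp x \<in> endpoints S" "y \<in> endpoints S"
      using P by (auto simp: xy is_path_def Reg_def endpoints_def opp_def)
    have "proj G (opp x) = proj G y"
      using P by (auto simp: xy is_path_iff_successively)
    then have "D y / D (opp x) = d y / d (opp x)"
      by (rule directions_vertex[OF D S'(2,3)])
    then show "[(\<Sum>j<length P - 1. ccw_angle (- d (opp (P ! j))) (d (P ! Suc j)))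
         = ccw_angle (- tau G \<Gamma> (opp (hd P))) (tau G \<Gamma> (last P))] (rmod (2 * pi))"
      using tau S' by (simp add: xy ccw_angle_def)
  qed
  ultimately show ?thesis
    unfolding straight_def using aff(2) by blast
qed

section \<open>Straightness\<close>

theorem proposition7p5:
  fixes G :: ngraph
    and d :: "real \<times> nat \<Rightarrow> complex"
    and H :: "nat set"
    and q :: nat
    and Hs :: "nat \<Rightarrow> nat set"
    and \<Sigma> :: "nat \<Rightarrow> (real \<times> nat) set \<Rightarrow> complex"
  assumes "is_ngraph G" and "assigned_angles G d"
    and "\<forall>p \<in> vertices G (edges G). vertex_order G p \<le> 4"
    and "\<forall>p \<in> vertices G (edges G). inj_on d (fiber G p) \<and>
           (\<forall>x \<in> fiber G p. \<forall>y \<in> fiber G p. x \<noteq> y \<longrightarrow>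
              (\<exists>n \<in> {1, 2, 3 :: nat}. ccw_angle (d x) (d y) = real n * pi / 2))"
    and "H \<subseteq> edges G" and "connected_subgraph G H"
    and "stratification G d H q Hs \<Sigma>"
    and "\<forall>i\<^sub>0 \<in> Sing G H (\<Sigma> 0).
           \<not> (\<exists>P. is_cycle G P \<and> path_in P H \<and>
                (\<exists>z\<^sub>0 \<in> {0, 1}. P ! 0 = (z\<^sub>0, i\<^sub>0) \<and>
                   (\<exists>D. canonical_assignment G d H (z\<^sub>0, i\<^sub>0) D \<and>
                        (\<forall>j. 1 \<le> j \<and> j < length P \<longrightarrow> D (P ! j) \<noteq> - 1))))"
  shows "straight G d H"
proof (cases "H = {}")
  case True
  then show ?thesis
    using assms(1,2) by (intro straight_if_positions[where D = d])
      (auto simp: directions_def endpoints_def assigned_angles_def)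
next
  case False
  let ?S = "Sing G H (\<Sigma> 0)" and ?R = "Reg G H (\<Sigma> 0)"
  note G = assms(1) and H = assms(5) and conn = assms(6)
  have d: "norm (d x) = 1" if "x \<in> endpoints (edges G)" for x
    using assms(2) that by (simp add: assigned_angles_def)
  have "q > 0"
    using False assms(7) by (cases q) (auto simp: stratification_def)
  with assms(7) have network: "is_network G H (\<Sigma> 0)" and angle: "angle_condition G d H (\<Sigma> 0)"
    and segments: "\<And>i. i \<in> H \<Longrightarrow> straight_curve (curve G (\<Sigma> 0) i)" and proper: "?S \<subset> H"
    unfolding stratification_def by (metis, metis, metis, metis)
  have SR: "H = ?S \<union> ?R"
    using network by (auto simp: is_network_def Sing_def Reg_def)
  have nonempty: "?R \<noteq> {}"
    using proper SR by auto
  have regular: "H2_immersion (curve G (\<Sigma> 0) i)" "straight_curve (curve G (\<Sigma> 0) i)" if "i \<in> ?R" for i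
    using that segments by (auto simp: Reg_def)
  have tau1: "norm (tau G (\<Sigma> 0) x) = 1" and tau_opp: "tau G (\<Sigma> 0) (opp x) = - tau G (\<Sigma> 0) x"
    if "x \<in> endpoints ?R" for x
  proof -
    obtain z i where "x = (z, i)" "z \<in> {0, 1}" "i \<in> ?R"
      using \<open>x \<in> endpoints ?R\<close> by (cases x) (auto simp: endpoints_def)
    then show "norm (tau G (\<Sigma> 0) x) = 1" "tau G (\<Sigma> 0) (opp x) = - tau G (\<Sigma> 0) x"
      using tau_straight[OF regular] by (auto simp: opp_def norm_sgn)
  qed
  obtain D where D: "directions G d H D" and D_tau: "\<And>x. x \<in> endpoints ?R \<Longrightarrow> D x = tau G (\<Sigma> 0) x"
    using directions_exist[OF G H conn angle SR d tau1 tau_opp nonempty] by blast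
  let ?A = "shifted_region G H D"
  have tail: "proj G (0, i) \<notin> ?A i" if i: "i \<in> ?S" for i
  proof (rule shifted_region_tail, rule notI, elim exE conjE)
    fix P assume P: "is_cycle G P" "path_in P H" "hd P = (0, i)" "\<forall>x\<in>set (tl P). D x \<noteq> - D (0, i)"
    have i': "(0, i) \<in> endpoints H"
      using i by (auto simp: Sing_def endpoints_def)
    have "canonical_assignment G d H (0, i) (\<lambda>x. D x / D (0, i))"
      by (rule directions_canonical_assignment[OF G H conn d _ D i']) (use assms(4) in blast)+
    moreover have "D (P ! j) / D (0, i) \<noteq> - 1" if "1 \<le> j" "j < length P" for j
    proof -
      have "P ! j = tl P ! (j - 1)" "j - 1 < length (tl P)"
        using that by (auto simp: nth_tl)
      then have "P ! j \<in> set (tl P)"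
        by (metis nth_mem)
      then show ?thesis
        using P(4) directionsD(3)[OF D i'] by (auto simp: divide_eq_eq)
    qed
    moreover have "P ! 0 = (0, i)"
      using P(1,3) by (simp add: is_cycle_def is_path_def hd_conv_nth)
    ultimately show False
      using assms(8) i P(1,2) by blast
  qed
  (* Start from the positions in the first stratum and add one unit shift per singular edge. *)
  define X where "X p = \<Sigma> 0 p + (\<Sum>i\<in>?S. D (0, i) * of_bool (p \<in> ?A i))" for p
  have "finite ?S"
    using H by (auto simp: Sing_def edges_def intro: finite_subset)
  show ?thesis
  proof (rule straight_if_positions[OF G H d D, where X = X])
    fix k assume k: "k \<in> H"
    have k': "(0, k) \<in> endpoints H"
      using k by (simp add: endpoints_def)
    obtain c where c: "\<And>i. c i \<ge> 0"
      "\<And>i. D (0, i) * (of_bool (proj G (1, k) \<in> ?A i) - of_bool (proj G (0, k) \<in> ?A i))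
        = of_real (c i) * D (0, k)"
      using shift_lengthens_edges[OF H D k] by metis
    have diff: "X (proj G (1, k)) - X (proj G (0, k))
        = \<Sigma> 0 (proj G (1, k)) - \<Sigma> 0 (proj G (0, k)) + of_real (\<Sum>i\<in>?S. c i) * D (0, k)"
      unfolding X_def of_real_sum sum_distrib_right c(2)[symmetric]
      by (simp add: sum_subtractf right_diff_distrib)
    have sum_c: "(\<Sum>i\<in>?S. c i) \<ge> 0"
      using c(1) by (simp add: sum_nonneg)
    show "\<exists>l>0. X (proj G (1, k)) - X (proj G (0, k)) = of_real l * D (0, k)"
    proof (cases "k \<in> ?S")
      case True
      have "\<Sigma> 0 (proj G (1, k)) = \<Sigma> 0 (proj G (0, k))"
        using True unfolding Sing_def singular_curve_def constant_on_def curve_def by force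
      moreover have "c k = 1"
        using c(2)[of k] shifted_region_head[OF H k, of D] tail[OF True] directionsD(3)[OF D k']
        by simp
      then have "(\<Sum>i\<in>?S. c i) > 0"
        using sum_pos2[OF \<open>finite ?S\<close> True, of c] c(1) by simp
      ultimately show ?thesis
        using diff by auto
    next
      case False
      define w where "w = \<Sigma> 0 (proj G (1, k)) - \<Sigma> 0 (proj G (0, k))"
      have R: "k \<in> ?R"
        using False SR k by blast
      then have "D (0, k) = sgn w" "w \<noteq> 0"
        using D_tau[of "(0, k)"] tau_straight[OF regular[OF R]] by (auto simp: endpoints_def w_def)
      then have "w = of_real (norm w) * D (0, k)" "norm w > 0"
        by (auto simp: sgn_eq)
      then show ?thesis
        using diff sum_c unfolding w_def[symmetric]
        by (intro exI[of _ "norm w + (\<Sum>i\<in>?S. c i)"]) (simp add: distrib_right add_pos_nonneg)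
    qed
  qed
qed

end
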